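(* Let $\mathbf{Y}\in\mathbb{R}^n$, $\mathbf{f}_1,\dots,\mathbf{f}_M\in\mathbb{R}^n$, $\boldsymbol{\pi}\in\Lambda^M$, $\nu\in(0,1)$, $\omega>0$, and suppose there is a constant $L\in\mathbb{R}$ with $\|\mathbf{f}_j\|_2\le L$ for all $j=1,\dots,M$. Put $A_1=\frac{1-\nu}{\omega^2}$ and $A_2=\frac{1-\nu}{\omega^2}+\left(\frac{1-\nu}{\omega^2}\right)^2L^2$. Let $\boldsymbol{\psi}^{(k)}$ be the iterates of the algorithm GD-BMAX described in the context, with fixed step size $t_k=s\in(0,2/A_2)$ for all $k>0$. Then for every $k\ge1$, $$\log J(\boldsymbol{\psi}^{(k)})-\log J(\boldsymbol{\psi}_X(\omega^2,\nu))\le\left[1-2A_1\left(s-\tfrac{A_2}{2}s^2\right)\right]^k\left(\log J(\boldsymbol{\psi}^{(0)})-\log J(\boldsymbol{\psi}_X(\omega^2,\nu))\right).$$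
   Context: $\Lambda^M=\{\boldsymbol{\lambda}\in\mathbb{R}^M:\lambda_j\ge 0,\ \sum_{j=1}^M\lambda_j=1\}$. Define $$J(\boldsymbol{\psi})=\sum_{j=1}^M\pi_j\exp\left(-\frac{1}{2\omega^2}\|\mathbf{f}_j-\mathbf{Y}\|_2^2+\frac{1-\nu}{2\omega^2}\|\boldsymbol{\psi}-\mathbf{f}_j\|_2^2\right),\qquad\boldsymbol{\psi}_X(\omega^2,\nu)=\operatorname*{argmin}_{\boldsymbol{\psi}\in\mathbb{R}^n}J(\boldsymbol{\psi}).$$ Algorithm GD-BMAX with step sizes $t_k$: set $\boldsymbol{\psi}^{(0)}=0$; for $k=1,2,\dots$ let $\boldsymbol{\lambda}^{(k-1)}\in\Lambda^M$ be the probability vector with $$\lambda_j^{(k-1)}\propto\pi_j\exp\left(-\frac{1}{2\omega^2}\|\mathbf{f}_j-\mathbf{Y}\|_2^2+\frac{1-\nu}{2\omega^2}\|\boldsymbol{\psi}^{(k-1)}-\mathbf{f}_j\|_2^2\right),$$ and set $\boldsymbol{\psi}^{(k)}=\left(1-t_k\frac{1-\nu}{\omega^2}\right)\boldsymbol{\psi}^{(k-1)}+t_k\frac{1-\nu}{\omega^2}\sum_{j=1}^M\lambda_j^{(k-1)}\mathbf{f}_j$ (equivalently, $\boldsymbol{\psi}^{(k)}=\boldsymbol{\psi}^{(k-1)}-t_k\nabla\log J(\boldsymbol{\psi}^{(k-1)})$). *)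

theory Defs
  imports "HOL-Analysis.Analysis"
begin

text \<open>
  The \<open>M\<close> models are indexed by a finite type \<open>'m\<close> and the sample space is \<open>real ^ 'n\<close>, so
  that \<open>M\<close> and \<open>n\<close> are arbitrary positive numbers and \<open>norm\<close> is the Euclidean norm.
\<close>

definition prob_simplex :: "(real ^ 'm) set" where
  "prob_simplex = {l. (\<forall>j. 0 \<le> l $ j) \<and> (\<Sum>j\<in>UNIV. l $ j) = 1}"

definition bmax_term ::
    "real \<Rightarrow> real \<Rightarrow> real ^ 'm \<Rightarrow> ('m \<Rightarrow> real ^ 'n) \<Rightarrow> real ^ 'n \<Rightarrow> real ^ 'n \<Rightarrow> 'm \<Rightarrow> real" where
  "bmax_term \<omega> \<nu> \<pi> f Y \<psi> j =
     \<pi> $ j * exp (- (1 / (2 * \<omega>\<^sup>2)) * (norm (f j - Y))\<^sup>2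
                  + (1 - \<nu>) / (2 * \<omega>\<^sup>2) * (norm (\<psi> - f j))\<^sup>2)"

definition bmax_J ::
    "real \<Rightarrow> real \<Rightarrow> real ^ 'm \<Rightarrow> ('m \<Rightarrow> real ^ 'n) \<Rightarrow> real ^ 'n \<Rightarrow> real ^ 'n \<Rightarrow> real" where
  "bmax_J \<omega> \<nu> \<pi> f Y \<psi> = (\<Sum>j\<in>UNIV. bmax_term \<omega> \<nu> \<pi> f Y \<psi> j)"

text \<open>
  \<open>bmax_J\<close> is continuous, coercive and strictly convex for \<open>\<nu> < 1\<close>, \<open>\<omega> > 0\<close> and
  \<open>\<pi> \<in> prob_simplex\<close>, so there the choice operator below selects its unique global minimizer.
\<close>

definition bmax_psi ::
    "real \<Rightarrow> real \<Rightarrow> real ^ 'm \<Rightarrow> ('m \<Rightarrow> real ^ 'n) \<Rightarrow> real ^ 'n \<Rightarrow> real ^ 'n" where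
  "bmax_psi \<omega> \<nu> \<pi> f Y = (ARG_MIN (bmax_J \<omega> \<nu> \<pi> f Y) \<psi>. True)"

text \<open>The normalizing constant of the weights proportional to \<open>bmax_term\<close> is \<open>bmax_J\<close>.\<close>

definition gd_bmax_weights ::
    "real \<Rightarrow> real \<Rightarrow> real ^ 'm \<Rightarrow> ('m \<Rightarrow> real ^ 'n) \<Rightarrow> real ^ 'n \<Rightarrow> real ^ 'n \<Rightarrow> real ^ 'm" where
  "gd_bmax_weights \<omega> \<nu> \<pi> f Y \<psi> =
     (\<chi> j. bmax_term \<omega> \<nu> \<pi> f Y \<psi> j / (\<Sum>i\<in>UNIV. bmax_term \<omega> \<nu> \<pi> f Y \<psi> i))"

text \<open>Step \<open>Suc k\<close> uses step size \<open>t (Suc k)\<close>; the value \<open>t 0\<close> is irrelevant.\<close>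

primrec gd_bmax ::
    "real \<Rightarrow> real \<Rightarrow> real ^ 'm \<Rightarrow> ('m \<Rightarrow> real ^ 'n) \<Rightarrow> real ^ 'n \<Rightarrow> (nat \<Rightarrow> real) \<Rightarrow> nat \<Rightarrow> real ^ 'n"
where
  "gd_bmax \<omega> \<nu> \<pi> f Y t 0 = 0"
| "gd_bmax \<omega> \<nu> \<pi> f Y t (Suc k) =
     (1 - t (Suc k) * ((1 - \<nu>) / \<omega>\<^sup>2)) *\<^sub>R gd_bmax \<omega> \<nu> \<pi> f Y t k
     + (t (Suc k) * ((1 - \<nu>) / \<omega>\<^sup>2)) *\<^sub>R
         (\<Sum>j\<in>UNIV. gd_bmax_weights \<omega> \<nu> \<pi> f Y (gd_bmax \<omega> \<nu> \<pi> f Y t k) $ j *\<^sub>R f j)"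

lemma bmax_J_pos:
  assumes "\<pi> \<in> prob_simplex"
  shows "bmax_J \<omega> \<nu> \<pi> f Y \<psi> > 0"
proof -
  have nn: "\<And>j. 0 \<le> \<pi> $ j" and s1: "(\<Sum>j\<in>UNIV. \<pi> $ j) = 1"
    using assms by (auto simp: prob_simplex_def)
  have "\<exists>j. \<pi> $ j \<noteq> 0"
    using s1 by (metis sum.neutral zero_neq_one)
  then obtain j where "\<pi> $ j > 0"
    using nn by (metis less_eq_real_def)
  then show ?thesis
    unfolding bmax_J_def bmax_term_def
    by (intro sum_pos2[of _ j]) (auto simp: nn)
qed

lemma gd_bmax_weights_in_prob_simplex:
  assumes "\<pi> \<in> prob_simplex"
  shows "gd_bmax_weights \<omega> \<nu> \<pi> f Y \<psi> \<in> prob_simplex"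
proof -
  have pos: "(\<Sum>i\<in>UNIV. bmax_term \<omega> \<nu> \<pi> f Y \<psi> i) > 0"
    using bmax_J_pos[OF assms] by (simp add: bmax_J_def)
  have "bmax_term \<omega> \<nu> \<pi> f Y \<psi> j \<ge> 0" for j
    using assms by (simp add: prob_simplex_def bmax_term_def)
  with pos show ?thesis
    by (simp add: prob_simplex_def gd_bmax_weights_def flip: sum_divide_distrib)
qed

end

theory Submission
  imports Defs "HOL-Probability.Hoeffding"
begin

text \<open>
  Put \<open>a = (1 - \<nu>) / \<omega>\<^sup>2\<close>. Then \<open>log J\<close> is \<open>a/2 \<parallel>\<psi>\<parallel>\<^sup>2\<close> plus the logarithm of an exponential sum
  in \<open>\<psi>\<close>, so \<open>J (\<psi> + d) / J \<psi>\<close> is an explicit factor times the mean of \<open>exp (- a d \<bullet> f\<^sub>j)\<close> under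
  the weights of the algorithm at \<open>\<psi>\<close>. Jensen's inequality for this mean gives strong convexity
  of \<open>log J\<close> with modulus \<open>A\<^sub>1\<close>, and Hoeffding's lemma gives smoothness with constant \<open>A\<^sub>2\<close>; no
  Hessian is needed. Strong convexity gives the gradient domination
  \<open>log J \<psi> - log J \<phi> \<le> \<parallel>\<nabla> log J \<psi>\<parallel>\<^sup>2 / (2 A\<^sub>1)\<close> for all \<open>\<phi>\<close>, and together with the descent
  inequality coming from smoothness this makes every step contract the gap to any fixed \<open>\<phi>\<close>.
\<close>

lemma sum_mult_exp_ge:
  fixes w x :: "'a \<Rightarrow> real"
  assumes "finite S" "\<And>i. i \<in> S \<Longrightarrow> 0 \<le> w i" "sum w S = 1"
  shows "exp (\<Sum>i\<in>S. w i * x i) \<le> (\<Sum>i\<in>S. w i * exp (x i))"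
  using convex_on_sum[OF assms(1) _ exp_convex, of w x] assms by fastforce

text \<open>Hoeffding's lemma for a finite distribution. Replacing \<open>exp\<close> by its chord
  over the interval from \<open>- B\<close> to \<open>B\<close> reduces the claim to a two-point
  distribution with the same mean.\<close>

lemma sum_mult_exp_le:
  fixes w x :: "'a \<Rightarrow> real"
  assumes S: "finite S" and w: "\<And>i. i \<in> S \<Longrightarrow> 0 \<le> w i" "sum w S = 1"
    and x: "\<And>i. i \<in> S \<Longrightarrow> \<bar>x i\<bar> \<le> B" and B: "0 \<le> B"
  shows "(\<Sum>i\<in>S. w i * exp (x i)) \<le> exp ((\<Sum>i\<in>S. w i * x i) + B\<^sup>2 / 2)"
proof (cases "B = 0")
  case True
  with x have "\<And>i. i \<in> S \<Longrightarrow> x i = 0" by force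
  with True w show ?thesis by simp
next
  case False
  with B have B: "B > 0" by simp
  define m where "m = (\<Sum>i\<in>S. w i * x i)"
  \<comment> \<open>The mass at \<open>B\<close> of the distribution on \<open>- B\<close> and
    \<open>B\<close> with mean \<open>m\<close>.\<close>
  define p where "p = (m + B) / (2 * B)"
  have "0 \<le> (\<Sum>i\<in>S. w i * (x i + B))"
    using x w(1) by (intro sum_nonneg mult_nonneg_nonneg) (force simp: abs_le_iff)+
  also have "\<dots> = m + B"
    by (simp add: distrib_left sum.distrib m_def w(2) flip: sum_distrib_right)
  finally have p: "0 \<le> p" using B by (simp add: p_def)
  \<comment> \<open>Factoring out \<open>exp (- B)\<close> leaves the shape
    \<open>1 + p * (exp h - 1)\<close> of \<open>Hoeffdings_lemma_aux\<close>, with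
    \<open>h = 2 * B\<close>.\<close>
  have chord: "exp (x i) \<le> exp (- B) * (1 + (x i + B) / (2 * B) * (exp (2 * B) - 1))"
    if "i \<in> S" for i
  proof -
    define y where "y = (x i + B) / (2 * B)"
    have y: "0 \<le> y" "y \<le> 1" using x[OF that] B by (auto simp: y_def field_simps abs_le_iff)
    have eq: "(1 - y) *\<^sub>R (- B) + y *\<^sub>R B = x i" using B by (simp add: y_def field_simps)
    have "exp (x i) \<le> (1 - y) * exp (- B) + y * exp B"
      using convex_onD[OF exp_convex y, of "- B" B] by (simp only: eq) simp
    also have "exp B = exp (- B) * exp (2 * B)" by (simp flip: exp_add)
    finally have "exp (x i) \<le> exp (- B) * (1 + y * (exp (2 * B) - 1))"
      by (simp add: algebra_simps)
    then show ?thesis by (simp only: y_def)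
  qed
  have "(\<Sum>i\<in>S. w i * exp (x i))
      \<le> (\<Sum>i\<in>S. w i * (exp (- B) * (1 + (x i + B) / (2 * B) * (exp (2 * B) - 1))))"
    using chord w(1) by (intro sum_mono mult_left_mono) auto
  also have "\<dots> = (\<Sum>i\<in>S. w i * exp (- B)
      + (w i * x i + w i * B) * (exp (- B) / (2 * B) * (exp (2 * B) - 1)))"
    by (intro sum.cong) (simp_all add: algebra_simps)
  also have "\<dots> = exp (- B) + (m + B) * (exp (- B) / (2 * B) * (exp (2 * B) - 1))"
    by (simp only: sum.distrib sum_distrib_right[symmetric] w(2) m_def mult_1_left)
  also have "\<dots> = exp (- B) * (1 + p * (exp (2 * B) - 1))"
    using B by (simp add: p_def field_simps)
  also have "\<dots> \<le> exp (- B) * exp (m + B + B\<^sup>2 / 2)"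
  proof (rule mult_left_mono)
    have pos: "0 < 1 + p * (exp (2 * B) - 1)"
      using p B by (intro add_pos_nonneg mult_nonneg_nonneg) auto
    have "- (2 * B) * p + ln (1 + p * (exp (2 * B) - 1)) \<le> (2 * B)\<^sup>2 / 8"
      using Hoeffdings_lemma_aux[of "2 * B" p] p B by simp
    moreover have "2 * B * p = m + B" using B by (simp add: p_def)
    ultimately have "ln (1 + p * (exp (2 * B) - 1)) \<le> m + B + B\<^sup>2 / 2"
      by (simp add: power_mult_distrib)
    with pos show "1 + p * (exp (2 * B) - 1) \<le> exp (m + B + B\<^sup>2 / 2)"
      by (metis exp_le_cancel_iff exp_ln)
  qed simp
  also have "\<dots> = exp (m + B\<^sup>2 / 2)" by (simp flip: exp_add)
  finally show ?thesis by (simp add: m_def)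
qed

text \<open>The gradient of \<open>ln J\<close> in closed form. It enters through the two quadratic
  bounds on \<open>ln J\<close> below, not through derivatives.\<close>

definition bmax_grad ::
    "real \<Rightarrow> real \<Rightarrow> real ^ 'm \<Rightarrow> ('m \<Rightarrow> real ^ 'n) \<Rightarrow> real ^ 'n \<Rightarrow> real ^ 'n \<Rightarrow> real ^ 'n" where
  "bmax_grad \<omega> \<nu> \<pi> f Y \<psi> = ((1 - \<nu>) / \<omega>\<^sup>2) *\<^sub>R
     (\<psi> - (\<Sum>j\<in>UNIV. gd_bmax_weights \<omega> \<nu> \<pi> f Y \<psi> $ j *\<^sub>R f j))"

lemma gd_bmax_Suc_eq_grad_step:
  "gd_bmax \<omega> \<nu> \<pi> f Y t (Suc k) = gd_bmax \<omega> \<nu> \<pi> f Y t k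
     + (- t (Suc k)) *\<^sub>R bmax_grad \<omega> \<nu> \<pi> f Y (gd_bmax \<omega> \<nu> \<pi> f Y t k)"
  by (simp add: bmax_grad_def scaleR_diff_left scaleR_diff_right)

lemma inner_bmax_grad:
  "d \<bullet> bmax_grad \<omega> \<nu> \<pi> f Y \<psi> = (1 - \<nu>) / \<omega>\<^sup>2 * (d \<bullet> \<psi>)
     + (\<Sum>j\<in>UNIV. gd_bmax_weights \<omega> \<nu> \<pi> f Y \<psi> $ j * (- ((1 - \<nu>) / \<omega>\<^sup>2 * (d \<bullet> f j))))"
  by (simp add: bmax_grad_def inner_diff_right inner_sum_right sum_negf sum_distrib_left
      right_diff_distrib mult.left_commute)

text \<open>Once the square is expanded, only \<open>d \<bullet> f j\<close> couples the shift
  \<open>d\<close> to the index, so the other factor comes out of the sum over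
  \<open>j\<close>.\<close>

lemma bmax_term_add:
  "bmax_term \<omega> \<nu> \<pi> f Y (\<psi> + d) j = bmax_term \<omega> \<nu> \<pi> f Y \<psi> j
     * exp ((1 - \<nu>) / \<omega>\<^sup>2 * ((norm d)\<^sup>2 / 2 + d \<bullet> \<psi>)) * exp (- ((1 - \<nu>) / \<omega>\<^sup>2 * (d \<bullet> f j)))"
proof -
  have "(norm (\<psi> + d - f j))\<^sup>2 = (norm (\<psi> - f j))\<^sup>2 + 2 * ((norm d)\<^sup>2 / 2 + d \<bullet> \<psi> - d \<bullet> f j)"
    by (simp add: power2_norm_eq_inner inner_commute algebra_simps)
  then show ?thesis
    by (simp add: bmax_term_def mult.assoc flip: exp_add)
      (simp add: algebra_simps add_divide_distrib diff_divide_distrib)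
qed

lemma bmax_J_add:
  assumes "\<pi> \<in> prob_simplex"
  shows "bmax_J \<omega> \<nu> \<pi> f Y (\<psi> + d) = bmax_J \<omega> \<nu> \<pi> f Y \<psi>
     * exp ((1 - \<nu>) / \<omega>\<^sup>2 * ((norm d)\<^sup>2 / 2 + d \<bullet> \<psi>))
     * (\<Sum>j\<in>UNIV. gd_bmax_weights \<omega> \<nu> \<pi> f Y \<psi> $ j * exp (- ((1 - \<nu>) / \<omega>\<^sup>2 * (d \<bullet> f j))))"
proof -
  have "bmax_term \<omega> \<nu> \<pi> f Y \<psi> j = bmax_J \<omega> \<nu> \<pi> f Y \<psi> * gd_bmax_weights \<omega> \<nu> \<pi> f Y \<psi> $ j" for j
    using bmax_J_pos[OF assms, of \<omega> \<nu> f Y \<psi>]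
    by (simp add: gd_bmax_weights_def flip: bmax_J_def)
  then show ?thesis
    by (simp add: bmax_J_def[of _ _ _ _ _ "\<psi> + d"] bmax_term_add sum_distrib_left mult_ac)
qed

lemma ln_bmax_J_add:
  assumes "\<pi> \<in> prob_simplex"
  shows "ln (bmax_J \<omega> \<nu> \<pi> f Y (\<psi> + d)) = ln (bmax_J \<omega> \<nu> \<pi> f Y \<psi>)
     + (1 - \<nu>) / \<omega>\<^sup>2 * ((norm d)\<^sup>2 / 2 + d \<bullet> \<psi>)
     + ln (\<Sum>j\<in>UNIV. gd_bmax_weights \<omega> \<nu> \<pi> f Y \<psi> $ j * exp (- ((1 - \<nu>) / \<omega>\<^sup>2 * (d \<bullet> f j))))"
proof -
  note pos = bmax_J_pos[OF assms, of \<omega> \<nu> f Y]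
  note eq = bmax_J_add[OF assms, of \<omega> \<nu> f Y \<psi> d]
  \<comment> \<open>The mean is the remaining factor of a positive product whose other factors are
    positive.\<close>
  have "0 < (\<Sum>j\<in>UNIV. gd_bmax_weights \<omega> \<nu> \<pi> f Y \<psi> $ j * exp (- ((1 - \<nu>) / \<omega>\<^sup>2 * (d \<bullet> f j))))"
    using pos[of "\<psi> + d"] pos[of \<psi>] unfolding eq
    by (rule zero_less_mult_pos[OF _ mult_pos_pos[OF _ exp_gt_zero]])
  then show ?thesis unfolding eq using pos[of \<psi>] by (simp add: ln_mult)
qed

text \<open>By Jensen, the logarithm of the mean is at least the mean of the exponents, which is the
  model part of \<open>d \<bullet> bmax_grad\<close>; the quadratic term is carried over
  exactly.\<close>

lemma ln_bmax_J_strongly_convex: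
  assumes "\<pi> \<in> prob_simplex"
  shows "ln (bmax_J \<omega> \<nu> \<pi> f Y \<psi>) + d \<bullet> bmax_grad \<omega> \<nu> \<pi> f Y \<psi> + (1 - \<nu>) / \<omega>\<^sup>2 / 2 * (norm d)\<^sup>2
    \<le> ln (bmax_J \<omega> \<nu> \<pi> f Y (\<psi> + d))"
proof -
  define w where "w = (\<lambda>j. gd_bmax_weights \<omega> \<nu> \<pi> f Y \<psi> $ j)"
  define x where "x = (\<lambda>j. - ((1 - \<nu>) / \<omega>\<^sup>2 * (d \<bullet> f j)))"
  have w: "0 \<le> w j" "sum w UNIV = 1" for j
    using gd_bmax_weights_in_prob_simplex[OF assms, of \<omega> \<nu> f Y \<psi>] by (auto simp: prob_simplex_def w_def)
  have le: "exp (\<Sum>j\<in>UNIV. w j * x j) \<le> (\<Sum>j\<in>UNIV. w j * exp (x j))"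
    by (rule sum_mult_exp_ge) (simp_all add: w)
  then have "(\<Sum>j\<in>UNIV. w j * x j) \<le> ln (\<Sum>j\<in>UNIV. w j * exp (x j))"
    by (meson exp_gt_zero less_le_trans ln_ge_iff)
  then show ?thesis
    unfolding ln_bmax_J_add[OF assms] inner_bmax_grad by (simp add: w_def x_def algebra_simps)
qed

text \<open>The exponents are at most \<open>a * (norm d * L)\<close> in absolute value by
  Cauchy-Schwarz, so Hoeffding's lemma contributes the summand with
  \<open>L\<^sup>2\<close>.\<close>

lemma ln_bmax_J_smooth:
  assumes \<pi>: "\<pi> \<in> prob_simplex" and \<nu>: "\<nu> \<le> 1" and f: "\<And>j. norm (f j) \<le> L"
  shows "ln (bmax_J \<omega> \<nu> \<pi> f Y (\<psi> + d))
    \<le> ln (bmax_J \<omega> \<nu> \<pi> f Y \<psi>) + d \<bullet> bmax_grad \<omega> \<nu> \<pi> f Y \<psi>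
      + ((1 - \<nu>) / \<omega>\<^sup>2 + ((1 - \<nu>) / \<omega>\<^sup>2)\<^sup>2 * L\<^sup>2) / 2 * (norm d)\<^sup>2"
proof -
  define a where "a = (1 - \<nu>) / \<omega>\<^sup>2"
  define w where "w = (\<lambda>j. gd_bmax_weights \<omega> \<nu> \<pi> f Y \<psi> $ j)"
  define x where "x = (\<lambda>j. - (a * (d \<bullet> f j)))"
  have a: "0 \<le> a" using \<nu> by (simp add: a_def)
  have L: "0 \<le> L" using f norm_ge_zero order_trans by blast
  have w: "0 \<le> w j" "sum w UNIV = 1" for j
    using gd_bmax_weights_in_prob_simplex[OF \<pi>, of \<omega> \<nu> f Y \<psi>] by (auto simp: prob_simplex_def w_def)
  have x: "\<bar>x j\<bar> \<le> a * (norm d * L)" for j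
  proof -
    have "\<bar>d \<bullet> f j\<bar> \<le> norm d * norm (f j)" by (rule Cauchy_Schwarz_ineq2)
    also have "\<dots> \<le> norm d * L" using f by (intro mult_left_mono) auto
    finally show ?thesis using a by (simp add: x_def abs_mult mult_left_mono)
  qed
  have "(\<Sum>j\<in>UNIV. w j * exp (x j)) \<le> exp ((\<Sum>j\<in>UNIV. w j * x j) + (a * (norm d * L))\<^sup>2 / 2)"
    using a L by (intro sum_mult_exp_le) (auto simp: w x)
  moreover have "0 < (\<Sum>j\<in>UNIV. w j * exp (x j))"
    using sum_mult_exp_ge[of UNIV w x] w by (meson exp_gt_zero less_le_trans finite)
  ultimately have "ln (\<Sum>j\<in>UNIV. w j * exp (x j)) \<le> (\<Sum>j\<in>UNIV. w j * x j) + (a * (norm d * L))\<^sup>2 / 2"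
    by (metis exp_le_cancel_iff exp_ln)
  then show ?thesis
    unfolding ln_bmax_J_add[OF \<pi>] inner_bmax_grad
    by (simp add: w_def x_def algebra_simps add_divide_distrib power_mult_distrib flip: a_def)
qed

text \<open>A Polyak-Lojasiewicz inequality: the strong convexity bound is quadratic in
  \<open>d = \<phi> - \<psi>\<close>, and completing the square bounds it uniformly in
  \<open>d\<close>.\<close>

lemma ln_bmax_J_gradient_domination:
  assumes \<pi>: "\<pi> \<in> prob_simplex" and a: "0 < (1 - \<nu>) / \<omega>\<^sup>2"
  shows "2 * ((1 - \<nu>) / \<omega>\<^sup>2) * (ln (bmax_J \<omega> \<nu> \<pi> f Y \<psi>) - ln (bmax_J \<omega> \<nu> \<pi> f Y \<phi>))
    \<le> (norm (bmax_grad \<omega> \<nu> \<pi> f Y \<psi>))\<^sup>2"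
proof -
  define a where "a = (1 - \<nu>) / \<omega>\<^sup>2"
  define g where "g = bmax_grad \<omega> \<nu> \<pi> f Y \<psi>"
  define d where "d = \<phi> - \<psi>"
  define D where "D = ln (bmax_J \<omega> \<nu> \<pi> f Y \<psi>) - ln (bmax_J \<omega> \<nu> \<pi> f Y \<phi>)"
  have "D \<le> - (d \<bullet> g) - a / 2 * (norm d)\<^sup>2"
    using ln_bmax_J_strongly_convex[OF \<pi>, of \<omega> \<nu> f Y \<psi> d]
    by (simp add: D_def d_def g_def a_def)
  then have "2 * a * D \<le> 2 * a * (- (d \<bullet> g) - a / 2 * (norm d)\<^sup>2)"
    using a by (intro mult_left_mono) (simp_all flip: a_def)
  also have "\<dots> = (norm g)\<^sup>2 - (norm (g + a *\<^sub>R d))\<^sup>2"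
    by (simp add: power2_norm_eq_inner inner_commute algebra_simps)
  also have "\<dots> \<le> (norm g)\<^sup>2" by simp
  finally show ?thesis by (simp add: D_def g_def a_def)
qed

theorem proposition4:
  fixes Y :: "real ^ 'n"
    and f :: "'m::finite \<Rightarrow> real ^ 'n"
    and \<pi> :: "real ^ 'm"
    and \<nu> \<omega> L A1 A2 s :: real
    and t :: "nat \<Rightarrow> real"
    and k :: nat
  assumes "\<pi> \<in> prob_simplex"
    and "\<nu> \<in> {0<..<1}"
    and "\<omega> > 0"
    and "\<And>j. norm (f j) \<le> L"
    and "A1 = (1 - \<nu>) / \<omega>\<^sup>2"
    and "A2 = (1 - \<nu>) / \<omega>\<^sup>2 + ((1 - \<nu>) / \<omega>\<^sup>2)\<^sup>2 * L\<^sup>2"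
    and "s \<in> {0<..<2 / A2}"
    and "\<And>i. i > 0 \<Longrightarrow> t i = s"
    and "k \<ge> 1"
  shows "ln (bmax_J \<omega> \<nu> \<pi> f Y (gd_bmax \<omega> \<nu> \<pi> f Y t k))
           - ln (bmax_J \<omega> \<nu> \<pi> f Y (bmax_psi \<omega> \<nu> \<pi> f Y))
         \<le> (1 - 2 * A1 * (s - A2 / 2 * s\<^sup>2)) ^ k
             * (ln (bmax_J \<omega> \<nu> \<pi> f Y (gd_bmax \<omega> \<nu> \<pi> f Y t 0))
                - ln (bmax_J \<omega> \<nu> \<pi> f Y (bmax_psi \<omega> \<nu> \<pi> f Y)))"
proof -
  define g where "g = (\<lambda>\<psi>. ln (bmax_J \<omega> \<nu> \<pi> f Y \<psi>))"
  define x where "x = gd_bmax \<omega> \<nu> \<pi> f Y t"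
  define \<phi> where "\<phi> = bmax_psi \<omega> \<nu> \<pi> f Y"
  \<comment> \<open>The guaranteed decrease of \<open>g\<close> in one step, per unit of squared
    gradient norm.\<close>
  define c where "c = s - A2 / 2 * s\<^sup>2"
  have A1: "0 < A1" using assms(2,3,5) by simp
  have A12: "A1 \<le> A2" using assms(5,6) by simp
  with A1 have A2: "0 < A2" by simp
  have s: "0 < s" "s * A2 < 2" using assms(7) A2 by (auto simp: field_simps)
  have "c = s * (1 - s * A2 / 2)" by (simp add: c_def power2_eq_square algebra_simps)
  with s have c: "0 \<le> c" by simp
  \<comment> \<open>With \<open>A1 \<le> A2\<close> this makes the contraction factor nonnegative,
    so that the induction may multiply by it.\<close>
  have "2 * A2 * c = 1 - (1 - A2 * s)\<^sup>2" by (simp add: c_def power2_eq_square algebra_simps)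
  then have "2 * A2 * c \<le> 1" by simp
  then have q: "0 \<le> 1 - 2 * A1 * c" using mult_right_mono[OF A12 c] by simp
  have step: "g (x (Suc i)) - g \<phi> \<le> (1 - 2 * A1 * c) * (g (x i) - g \<phi>)" for i
  proof -
    define G where "G = bmax_grad \<omega> \<nu> \<pi> f Y (x i)"
    have "x (Suc i) = x i + (- s) *\<^sub>R G"
      unfolding x_def G_def gd_bmax_Suc_eq_grad_step by (simp add: assms(8))
    \<comment> \<open>Smoothness along \<open>d = - s G\<close>: the linear and quadratic terms add
      up to \<open>- c\<close> times the squared norm of \<open>G\<close>.\<close>
    then have "g (x (Suc i)) \<le> g (x i) + ((- s) *\<^sub>R G) \<bullet> G + A2 / 2 * (norm ((- s) *\<^sub>R G))\<^sup>2"
      using ln_bmax_J_smooth[of \<pi> \<nu> f L \<omega> Y "x i" "(- s) *\<^sub>R G", OF assms(1) _ assms(4)] assms(2)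
      by (simp only: g_def G_def assms(6)) simp
    also have "\<dots> = g (x i) - c * (norm G)\<^sup>2"
      by (simp add: c_def power_mult_distrib power2_norm_eq_inner algebra_simps)
    finally have "g (x (Suc i)) \<le> g (x i) - c * (norm G)\<^sup>2" .
    moreover have "2 * A1 * (g (x i) - g \<phi>) \<le> (norm G)\<^sup>2"
      using ln_bmax_J_gradient_domination[OF assms(1)] A1 unfolding assms(5) g_def G_def by blast
    then have "c * (2 * A1 * (g (x i) - g \<phi>)) \<le> c * (norm G)\<^sup>2"
      using c by (rule mult_left_mono)
    ultimately show ?thesis by (simp add: algebra_simps)
  qed
  have "g (x i) - g \<phi> \<le> (1 - 2 * A1 * c) ^ i * (g (x 0) - g \<phi>)" for i
  proof (induction i)
    case (Suc i)
    from order_trans[OF step mult_left_mono[OF Suc q]] show ?case by (simp add: mult.assoc)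
  qed simp
  then show ?thesis by (simp only: g_def x_def \<phi>_def c_def)
qed

end
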